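(* Let $\alpha,\beta>-1$ be real, let $n\in\mathbb N=\{0,1,2,\ldots\}$, and let $D^n_i(x;\alpha,\beta)$ be the dual Bernstein polynomials of degree $n$. For every $i=0,1,\ldots,n$ the following identity of polynomials in $x$ holds: $$x\frac{\mathrm d}{\mathrm dx}D^n_i(x;\alpha,\beta)+(i+\beta+1)D^n_i(x;\alpha,\beta)=\frac{i(n-i+\alpha+1)}{n-i+1}D^n_{i-1}(x;\alpha,\beta)+A^{(\alpha,\beta)}_{ni}\,\frac{n+\beta+1}{n-i+1}\,R^{(\alpha+1,\beta)}_n(x).$$
   Context: Pochhammer symbol: $(c)_0:=1$, $(c)_l:=c(c+1)\cdots(c+l-1)$ for $l\ge1$. Inner product: $\langle f,g\rangle_{\alpha,\beta}:=\int_0^1(1-x)^\alpha x^\beta f(x)g(x)\,\mathrm dx$. Bernstein basis polynomials: $B^n_i(x):=\binom{n}{i}x^i(1-x)^{n-i}$, $i=0,\ldots,n$; they form a basis of the space $\Pi_n$ of polynomials of degree at most $n$. Dual Bernstein polynomials of degree $n$: the polynomials $D^n_0(x;\alpha,\beta),\ldots,D^n_n(x;\alpha,\beta)\in\Pi_n$ determined by $\langle B^n_i,D^n_j(\cdot;\alpha,\beta)\rangle_{\alpha,\beta}=\delta_{ij}$ for $i,j=0,\ldots,n$. Convention: $D^n_i(x;\alpha,\beta):=0$ for $i<0$ or $i>n$. Shifted Jacobi polynomials (for parameters $a,b>-1$): $R^{(a,b)}_k(x):=\frac{(a+1)_k}{k!}\sum_{l=0}^{k}\frac{(-k)_l(k+a+b+1)_l}{(a+1)_l\,l!}(1-x)^l$.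 Constants: $\sigma:=\alpha+\beta+1$, $K:=\Gamma(\alpha+1)\Gamma(\beta+1)/\Gamma(\sigma+1)$, and $A^{(\alpha,\beta)}_{ni}:=\dfrac{(-1)^{n-i}(n+1)(\sigma+1)_n}{K\,(\alpha+1)_{n-i}(\beta+1)_i}$. *)

theory Defs
  imports "HOL-Analysis.Analysis" "HOL-Computational_Algebra.Polynomial"
begin

text \<open>For \<open>\<alpha>, \<beta> > -1\<close> the convention \<open>0 powr c = 0\<close> only affects the integrand at the two
  endpoints, hence not the integral.\<close>

definition jacobi_inner :: "real \<Rightarrow> real \<Rightarrow> (real \<Rightarrow> real) \<Rightarrow> (real \<Rightarrow> real) \<Rightarrow> real" where
  "jacobi_inner \<alpha> \<beta> f g =
     integral {0..1} (\<lambda>x. (1 - x) powr \<alpha> * x powr \<beta> * f x * g x)"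

text \<open>The index \<open>j\<close> is an integer so that the convention that the dual Bernstein polynomial
  vanishes outside \<open>0 \<le> j \<le> n\<close> includes negative indices. For \<open>\<alpha>, \<beta> > -1\<close> the weight is integrable
  and positive on \<open>(0,1)\<close>, and the Bernstein polynomials of degree \<open>n\<close> form a basis of the polynomials
  of degree at most \<open>n\<close>, so the description has exactly one solution for each \<open>0 \<le> j \<le> n\<close>.\<close>

definition dual_bernstein :: "real \<Rightarrow> real \<Rightarrow> nat \<Rightarrow> int \<Rightarrow> real poly" where
  "dual_bernstein \<alpha> \<beta> n j =
     (if 0 \<le> j \<and> j \<le> int n then
        (THE p. degree p \<le> n \<and>
           (\<forall>i\<le>n. jacobi_inner \<alpha> \<beta> (Bernstein n i) (poly p) = (if int i = j then 1 else 0)))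
      else 0)"

definition shifted_jacobi :: "real \<Rightarrow> real \<Rightarrow> nat \<Rightarrow> real poly" where
  "shifted_jacobi a b k =
     smult (pochhammer (a + 1) k / fact k)
       (\<Sum>l=0..k. smult (pochhammer (- real k) l * pochhammer (real k + a + b + 1) l
                         / (pochhammer (a + 1) l * fact l)) ([:1, -1:] ^ l))"

definition dual_sigma :: "real \<Rightarrow> real \<Rightarrow> real" where
  "dual_sigma \<alpha> \<beta> = \<alpha> + \<beta> + 1"

definition dual_K :: "real \<Rightarrow> real \<Rightarrow> real" where
  "dual_K \<alpha> \<beta> = Gamma (\<alpha> + 1) * Gamma (\<beta> + 1) / Gamma (dual_sigma \<alpha> \<beta> + 1)"

text \<open>Only used for \<open>i \<le> n\<close>, where the natural-number subtraction is exact.\<close>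

definition dual_A :: "real \<Rightarrow> real \<Rightarrow> nat \<Rightarrow> nat \<Rightarrow> real" where
  "dual_A \<alpha> \<beta> n i =
     (-1) ^ (n - i) * (real n + 1) * pochhammer (dual_sigma \<alpha> \<beta> + 1) n
     / (dual_K \<alpha> \<beta> * pochhammer (\<alpha> + 1) (n - i) * pochhammer (\<beta> + 1) i)"

end

theory Submission
  imports Defs
begin

text \<open>Write \<open>D\<^sub>i\<close> for the dual Bernstein polynomials, \<open>c\<close> for the coefficient of \<open>D\<^sub>i\<^sub>-\<^sub>1\<close>, and
  \<open>q = x D\<^sub>i' + (i + \<beta> + 1) D\<^sub>i - c D\<^sub>i\<^sub>-\<^sub>1\<close>. Integrating by parts against \<open>(1 - x) x\<^sup>k\<close>, \<open>k < n\<close>,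
  where the factor \<open>1 - x\<close> removes the boundary term, turns the pairing with \<open>q\<close> into pairings
  of \<open>D\<^sub>i\<close> and \<open>D\<^sub>i\<^sub>-\<^sub>1\<close> with polynomials of degree at most \<open>n\<close>, and these cancel. So \<open>q\<close> is
  orthogonal to all polynomials of degree less than \<open>n\<close> for the weight
  \<open>(1 - x)\<^bsup>\<alpha> + 1\<^esup> x\<^bsup>\<beta>\<^esup>\<close>, hence a multiple of \<open>R\<^sub>n\<^bsup>(\<alpha> + 1, \<beta>)\<^esup>\<close>. The factor follows
  by comparing leading coefficients; that of \<open>D\<^sub>i\<close> is obtained by pairing it with the orthogonal
  polynomial of degree \<open>n\<close>, expanded in the Bernstein basis. Integrals are evaluated as Beta
  functions, and every orthogonality relation becomes the vanishing of an \<open>n\<close>-th finite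
  difference of a polynomial of degree less than \<open>n\<close>.\<close>

section \<open>Linear functionals on polynomials and finite differences\<close>

text \<open>Reduces integral identities to monomials: \<open>T\<close> is taken as the integral
  expression in question, or as the difference of two sides to be proved equal.\<close>

lemma linear_functional_poly_eq_0:
  fixes T :: "'a::comm_ring_1 poly \<Rightarrow> 'a"
  assumes add: "\<And>p q. T (p + q) = T p + T q"
    and smult: "\<And>c p. T (smult c p) = c * T p"
    and monom: "\<And>k. k \<le> n \<Longrightarrow> T (monom 1 k) = 0"
    and "degree p \<le> n"
  shows "T p = 0"
proof -
  have T0: "T 0 = 0"
    using smult[of 0 0] by simp
  have monom': "T (monom c k) = 0" if "k \<le> n" for c k
    using smult[of c "monom 1 k"] monom[OF that] by (simp add: smult_monom)
  have "T (\<Sum>k\<le>m. monom (coeff p k) k) = 0" if "m \<le> n" for m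
    using that by (induction m) (simp_all add: add monom')
  then show ?thesis
    using poly_as_sum_of_monoms'[OF \<open>degree p \<le> n\<close>] by (metis order_refl)
qed

text \<open>Pascal's rule: up to sign, a difference of order \<open>n + 1\<close> is the difference
  of order \<open>n\<close> of the first difference.\<close>

lemma alternating_binomial_sum_Suc:
  fixes f :: "nat \<Rightarrow> 'a::comm_ring_1"
  shows "(\<Sum>j\<le>Suc n. (-1) ^ j * of_nat (Suc n choose j) * f j)
       = (\<Sum>j\<le>n. (-1) ^ j * of_nat (n choose j) * (f j - f (Suc j)))"
proof -
  have "(\<Sum>j\<le>Suc n. (-1) ^ j * of_nat (Suc n choose j) * f j)
      = f 0 + (\<Sum>j\<le>n. (-1) ^ Suc j * of_nat (Suc n choose Suc j) * f (Suc j))"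
    by (subst sum.atMost_Suc_shift) simp
  also have "\<dots> = (f 0 + (\<Sum>j\<le>n. (-1) ^ Suc j * of_nat (n choose Suc j) * f (Suc j)))
      - (\<Sum>j\<le>n. (-1) ^ j * of_nat (n choose j) * f (Suc j))"
    by (simp add: algebra_simps sum.distrib sum_negf sum_subtractf)
  also have "f 0 + (\<Sum>j\<le>n. (-1) ^ Suc j * of_nat (n choose Suc j) * f (Suc j))
      = (\<Sum>j\<le>Suc n. (-1) ^ j * of_nat (n choose j) * f j)"
    by (subst sum.atMost_Suc_shift) simp
  also have "\<dots> = (\<Sum>j\<le>n. (-1) ^ j * of_nat (n choose j) * f j)"
    by (simp add: binomial_eq_0)
  finally show ?thesis
    by (simp add: algebra_simps sum_subtractf)
qed

text \<open>The first difference of a rising factorial is a multiple of the one of order one less,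
  starting at \<open>x + 1\<close>. Each induction step therefore lowers \<open>k\<close> and
  \<open>n\<close> together and shifts \<open>c\<close>.\<close>

lemma alternating_binomial_sum_pochhammer:
  fixes c :: "'a::{comm_ring_1, ring_char_0}"
  assumes "k \<le> n"
  shows "(\<Sum>j\<le>n. (-1) ^ j * of_nat (n choose j) * pochhammer (c + of_nat j) k)
       = (if k = n then (-1) ^ n * fact n else 0)"
  using assms
proof (induction n arbitrary: k c)
  case 0
  then show ?case by simp
next
  case (Suc n)
  show ?case
  proof (cases k)
    case 0
    then show ?thesis
      using alternating_binomial_sum_Suc[of n "\<lambda>_. 1 :: 'a"] by simp
  next
    case (Suc m)
    have diff: "pochhammer x (Suc m) - pochhammer (x + 1) (Suc m)
        = - of_nat (Suc m) * pochhammer (x + 1) m" for x :: 'a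
      by (subst pochhammer_rec, subst pochhammer_rec') (simp add: algebra_simps)
    have "(\<Sum>j\<le>Suc n. (-1) ^ j * of_nat (Suc n choose j) * pochhammer (c + of_nat j) k)
        = (\<Sum>j\<le>n. (-1) ^ j * of_nat (n choose j)
            * (- of_nat (Suc m) * pochhammer (c + 1 + of_nat j) m))"
      using diff[of "c + of_nat j" for j]
      by (simp only: alternating_binomial_sum_Suc Suc) (simp add: add_ac)
    also have "\<dots> = - of_nat (Suc m)
        * (\<Sum>j\<le>n. (-1) ^ j * of_nat (n choose j) * pochhammer (c + 1 + of_nat j) m)"
      by (simp add: sum_distrib_left algebra_simps)
    also have "\<dots> = - of_nat (Suc m) * (if m = n then (-1) ^ n * fact n else 0)"
      using Suc.IH[of m "c + 1"] Suc.prems Suc by simp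
    also have "\<dots> = (if k = Suc n then (-1) ^ Suc n * fact (Suc n) else 0)"
      using Suc by (simp add: algebra_simps)
    finally show ?thesis .
  qed
qed

section \<open>Integration of polynomials against the Jacobi weight\<close>

text \<open>Takes the product of the two paired polynomials as a single argument, so that factors
  can be regrouped by ring arithmetic in \<open>real poly\<close>.\<close>

definition jacobi_integral :: "real \<Rightarrow> real \<Rightarrow> real poly \<Rightarrow> real" where
  "jacobi_integral a b p = integral {0..1} (\<lambda>x. (1 - x) powr a * x powr b * poly p x)"

text \<open>At \<open>y = 0\<close> both sides vanish since \<open>0 powr c = 0\<close>, so the
  endpoints of the interval need no separate treatment later.\<close>

lemma powr_mult_power:
  fixes y :: real
  assumes "0 \<le> y"
  shows "y powr a * y ^ k = y powr (a + real k)"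
  using assms by (cases "y = 0") (auto simp: powr_add powr_realpow)

lemma has_integral_jacobi_Beta:
  assumes "a > -1" "b > -1"
  shows "((\<lambda>x. (1 - x) powr a * x powr b * poly (monom 1 j * [:1, -1:] ^ l) x)
           has_integral Beta (b + real j + 1) (a + real l + 1)) {0..1}"
proof -
  have "((\<lambda>x. x powr (b + real j + 1 - 1) * (1 - x) powr (a + real l + 1 - 1))
           has_integral Beta (b + real j + 1) (a + real l + 1)) {0..1}"
    using assms by (intro has_integral_Beta_real) auto
  then show ?thesis
  proof (rule has_integral_eq[rotated])
    fix x :: real
    assume x: "x \<in> {0..1}"
    have "x powr (b + real j) * (1 - x) powr (a + real l)
        = (x powr b * x ^ j) * ((1 - x) powr a * (1 - x) ^ l)"
      using x by (simp add: powr_mult_power)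
    then show "x powr (b + real j + 1 - 1) * (1 - x) powr (a + real l + 1 - 1)
        = (1 - x) powr a * x powr b * poly (monom 1 j * [:1, -1:] ^ l) x"
      by (simp add: poly_monom mult_ac)
  qed
qed

lemma integrable_jacobi_poly:
  fixes a b :: real
  assumes "a > -1" "b > -1"
  shows "(\<lambda>x. (1 - x) powr a * x powr b * poly p x) integrable_on {0..1}"
proof -
  have "(\<lambda>x. (1 - x) powr a * x powr b * x ^ k) integrable_on {0..1}" for k
    using has_integral_jacobi_Beta[OF assms, of k 0]
    by (auto simp: has_integral_iff poly_monom)
  from integrable_cmul[OF this]
  have "(\<lambda>x. coeff p k * ((1 - x) powr a * x powr b * x ^ k)) integrable_on {0..1}" for k
    by simp
  then have "(\<lambda>x. \<Sum>k\<le>degree p. coeff p k * ((1 - x) powr a * x powr b * x ^ k)) integrable_on {0..1}"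
    by (intro integrable_sum) auto
  then show ?thesis
    by (simp add: poly_altdef sum_distrib_left mult_ac)
qed

lemma jacobi_integral_Beta:
  assumes "a > -1" "b > -1"
  shows "jacobi_integral a b (monom 1 j * [:1, -1:] ^ l) = Beta (b + real j + 1) (a + real l + 1)"
  using has_integral_jacobi_Beta[OF assms] unfolding jacobi_integral_def by (rule integral_unique)

lemma jacobi_integral_add:
  assumes "a > -1" "b > -1"
  shows "jacobi_integral a b (p + q) = jacobi_integral a b p + jacobi_integral a b q"
  unfolding jacobi_integral_def
  using integral_add[OF integrable_jacobi_poly integrable_jacobi_poly, OF assms assms, of p q]
  by (simp add: distrib_left)

lemma jacobi_integral_smult: "jacobi_integral a b (smult c p) = c * jacobi_integral a b p"
  unfolding jacobi_integral_def
  using integral_cmul[of "{0..1}" c "\<lambda>x. (1 - x) powr a * x powr b * poly p x"]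
  by (simp add: mult_ac)

lemma jacobi_integral_diff:
  assumes "a > -1" "b > -1"
  shows "jacobi_integral a b (p - q) = jacobi_integral a b p - jacobi_integral a b q"
  using jacobi_integral_add[OF assms, of p "smult (-1) q"] jacobi_integral_smult[of a b "-1" q]
  by simp

lemma jacobi_integral_sum:
  assumes "a > -1" "b > -1"
  shows "jacobi_integral a b (\<Sum>i\<in>A. f i) = (\<Sum>i\<in>A. jacobi_integral a b (f i))"
proof -
  have "jacobi_integral a b 0 = 0"
    by (simp add: jacobi_integral_def)
  then show ?thesis
    by (induction A rule: infinite_finite_induct) (simp_all add: jacobi_integral_add[OF assms])
qed

text \<open>Moves a factor \<open>1 - x\<close> from the weight to the polynomial: orthogonality for
  the exponent \<open>a + 1\<close> becomes a statement for the exponent \<open>a\<close>, where the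
  duality relations live.\<close>

lemma jacobi_integral_shift: "jacobi_integral (a + 1) b p = jacobi_integral a b ([:1, -1:] * p)"
  unfolding jacobi_integral_def
proof (rule integral_cong)
  fix x :: real
  assume "x \<in> {0..1}"
  then have "(1 - x) powr (a + 1) = (1 - x) powr a * (1 - x)"
    using powr_mult_power[of "1 - x" a 1] by simp
  moreover have "poly ([:1, -1:] * p) x = (1 - x) * poly p x"
    by (simp add: algebra_simps)
  ultimately show "(1 - x) powr (a + 1) * x powr b * poly p x
      = (1 - x) powr a * x powr b * poly ([:1, -1:] * p) x"
    by (simp only: mult_ac)
qed

lemma monom_Suc_eq_mult: "monom (1::real) (Suc k) = [:0, 1:] * monom 1 k"
  by (simp add: monom_Suc)

lemma x_pderiv_monom: "[:0, 1:] * pderiv (monom (1::real) k) = smult (real k) (monom 1 k)"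
  by (cases k) (simp_all add: pderiv_monom smult_monom flip: monom_Suc)

text \<open>The integral of the derivative of \<open>(1 - x)\<^bsup>a + 1\<^esup> x\<^bsup>b + 1\<^esup> f(x)\<close>; on monomials it is
  the functional equation of the Beta function, which avoids limits at the endpoints.\<close>

lemma jacobi_integral_by_parts:
  assumes "a > -1" "b > -1"
  shows "jacobi_integral a b ([:0, 1:] * [:1, -1:] * pderiv f + smult (b + 1) ([:1, -1:] * f)
           - smult (a + 1) ([:0, 1:] * f)) = 0"
proof -
  define T where "T f = jacobi_integral a b ([:0, 1:] * [:1, -1:] * pderiv f
    + smult (b + 1) ([:1, -1:] * f) - smult (a + 1) ([:0, 1:] * f))" for f
  have T_add: "T (p + q) = T p + T q" for p q
  proof -
    \<comment> \<open>\<open>X\<close> and \<open>Y\<close> are kept generic so that simplification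
      does not multiply out the explicit linear polynomials.\<close>
    have "X * Y * pderiv (p + q) + smult (b + 1) (Y * (p + q)) - smult (a + 1) (X * (p + q))
        = (X * Y * pderiv p + smult (b + 1) (Y * p) - smult (a + 1) (X * p))
          + (X * Y * pderiv q + smult (b + 1) (Y * q) - smult (a + 1) (X * q))" for X Y
      by (simp add: pderiv_add distrib_left smult_add_right)
    from arg_cong[OF this, of "jacobi_integral a b"] show ?thesis
      unfolding T_def jacobi_integral_add[OF assms, symmetric] .
  qed
  have T_smult: "T (smult c p) = c * T p" for c p
  proof -
    have "X * Y * pderiv (smult c p) + smult (b + 1) (Y * smult c p) - smult (a + 1) (X * smult c p)
        = smult c (X * Y * pderiv p + smult (b + 1) (Y * p) - smult (a + 1) (X * p))" for X Y
      by (simp add: pderiv_smult smult_add_right smult_diff_right mult.commute)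
    then show ?thesis
      unfolding T_def by (simp only: jacobi_integral_smult)
  qed
  have T_monom: "T (monom 1 k) = 0" for k
  proof -
    have poly_eq: "[:0, 1:] * [:1, -1:] * pderiv (monom 1 k) + smult (b + 1) ([:1, -1:] * monom 1 k)
        - smult (a + 1) ([:0, 1:] * monom 1 k)
        = smult (b + real k + 1) (monom 1 k * [:1, -1:] ^ 1)
          - smult (a + 1) (monom 1 (Suc k) * [:1, -1:] ^ 0)"
    proof -
      have "X * Y * P + smult (b + 1) (Y * m) - smult (a + 1) (X * m)
          = smult (b + real k + 1) (m * Y ^ 1) - smult (a + 1) (X * m * Y ^ 0)"
        if "X * P = smult (real k) m" for X Y P m :: "real poly"
      proof -
        have "X * Y * P = Y * (X * P)"
          by (simp only: mult_ac)
        also note that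
        finally have "X * Y * P = smult (real k) (Y * m)"
          by (simp only: mult_smult_right)
        then show ?thesis
          by (simp only:) (simp add: smult_add_left algebra_simps)
      qed
      from this[OF x_pderiv_monom] show ?thesis
        by (simp only: monom_Suc_eq_mult)
    qed
    \<comment> \<open>After multiplication by \<open>x + y\<close>, both sides equal
      \<open>x * y * Beta x y\<close>.\<close>
    have "x * Beta x (y + 1) = y * Beta (x + 1) y" if "x > 0" "y > 0" for x y :: real
    proof -
      have "x \<notin> \<int>\<^sub>\<le>\<^sub>0" "y \<notin> \<int>\<^sub>\<le>\<^sub>0"
        using that by (auto simp: nonpos_Ints_def)
      then have "(x + y) * (x * Beta x (y + 1)) = (x + y) * (y * Beta (x + 1) y)"
        using Beta_plus1_left[of x y] Beta_plus1_right[of y x] by (simp add: mult_ac)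
      then show ?thesis using that by simp
    qed
    from this[of "b + real k + 1" "a + 1"]
    have "(b + real k + 1) * Beta (b + real k + 1) (a + 2) = (a + 1) * Beta (b + real k + 2) (a + 1)"
      using assms by (simp add: add_ac)
    then show ?thesis
      unfolding T_def poly_eq jacobi_integral_diff[OF assms] jacobi_integral_smult jacobi_integral_Beta[OF assms]
      by (simp add: add_ac)
  qed
  have "T f = 0"
    by (rule linear_functional_poly_eq_0[where T = T and n = "degree f", OF T_add T_smult T_monom order_refl])
  then show ?thesis
    by (simp only: T_def)
qed

section \<open>Orthogonal polynomials, nondegeneracy and prescribed moments\<close>

text \<open>A multiple of the Jacobi polynomial, in the expansion given by Rodrigues' formula. The Gamma
  factors cancel those of the Beta integrals, so that moments become finite differences.\<close>

definition jacobi_bernstein :: "real \<Rightarrow> real \<Rightarrow> nat \<Rightarrow> real poly" where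
  "jacobi_bernstein a b n =
     (\<Sum>j\<le>n. smult ((-1) ^ j * real (n choose j) / (Gamma (b + real j + 1) * Gamma (a + real (n - j) + 1)))
       (monom 1 j * [:1, -1:] ^ (n - j)))"

text \<open>The exponents of \<open>x\<close> and \<open>1 - x\<close> in each term add up to
  \<open>n + k\<close>, so all Beta values share one denominator. What remains under the sum is a
  rising factorial of order \<open>k\<close> in \<open>j\<close>.\<close>

lemma jacobi_bernstein_moment:
  assumes "a > -1" "b > -1" "k \<le> n"
  shows "jacobi_integral a b (jacobi_bernstein a b n * monom 1 k)
       = (if k = n then (-1) ^ n * fact n / Gamma (a + b + 2 * real n + 2) else 0)"
proof -
  have "jacobi_integral a b (jacobi_bernstein a b n * monom 1 k)
     = (\<Sum>j\<le>n. (-1) ^ j * real (n choose j) / (Gamma (b + real j + 1) * Gamma (a + real (n - j) + 1))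
        * Beta (b + real (j + k) + 1) (a + real (n - j) + 1))"
    unfolding jacobi_bernstein_def sum_distrib_right jacobi_integral_sum[OF assms(1,2)]
  proof (rule sum.cong[OF refl], goal_cases)
    case (1 j)
    have "monom 1 j * [:1, -1:] ^ (n - j) * monom 1 k = monom (1::real) (j + k) * [:1, -1:] ^ (n - j)"
      using mult_monom[of "1::real" j 1 k] by (simp add: mult_ac)
    then show ?case
      by (simp only: mult_smult_left jacobi_integral_smult jacobi_integral_Beta[OF assms(1,2)])
  qed
  also have "\<dots> = (\<Sum>j\<le>n. (-1) ^ j * real (n choose j) * pochhammer (b + 1 + real j) k)
      / Gamma (a + b + real n + real k + 2)"
    unfolding sum_divide_distrib
  proof (rule sum.cong[OF refl], goal_cases)
    case (1 j)
    then have "j \<le> n" by simp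
    have pos: "Gamma (b + real j + 1) > 0" "Gamma (a + real (n - j) + 1) > 0"
      using assms by (auto intro!: Gamma_real_pos)
    have "pochhammer (b + 1 + real j) k = Gamma (b + real (j + k) + 1) / Gamma (b + real j + 1)"
      using assms by (subst pochhammer_Gamma) (auto simp: add_ac nonpos_Ints_def)
    moreover
    have "b + real (j + k) + 1 + (a + real (n - j) + 1) = a + b + real n + real k + 2"
      using \<open>j \<le> n\<close> by (simp add: of_nat_diff)
    then have "Beta (b + real (j + k) + 1) (a + real (n - j) + 1)
        = Gamma (b + real (j + k) + 1) * Gamma (a + real (n - j) + 1) / Gamma (a + b + real n + real k + 2)"
      by (simp only: Beta_def)
    ultimately show ?case
      using pos by (simp del: of_nat_diff of_nat_add)
  qed
  also have "\<dots> = (if k = n then (-1) ^ n * fact n / Gamma (a + b + 2 * real n + 2) else 0)"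
    unfolding alternating_binomial_sum_pochhammer[OF assms(3)]
    by (auto intro!: arg_cong[where f = Gamma])
  finally show ?thesis .
qed

lemma degree_jacobi_bernstein: "degree (jacobi_bernstein a b n) \<le> n"
  unfolding jacobi_bernstein_def
proof (intro degree_sum_le order_trans[OF degree_smult_le], goal_cases)
  case (2 j)
  have "degree (monom (1::real) j * [:1, -1:] ^ (n - j)) \<le> j + (n - j)"
    by (intro order_trans[OF degree_mult_le] add_mono degree_monom_le)
       (simp add: degree_linear_power degree_power_eq)
  then show ?case using 2 by simp
qed simp

text \<open>Only the \<open>x^n\<close> part of \<open>p\<close> survives, so this pairing reads off
  the coefficient at \<open>n\<close> up to a nonzero factor.\<close>

lemma jacobi_bernstein_pairing:
  assumes "a > -1" "b > -1" "degree p \<le> n"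
  shows "jacobi_integral a b (jacobi_bernstein a b n * p)
       = coeff p n * ((-1) ^ n * fact n / Gamma (a + b + 2 * real n + 2))"
proof -
  define c where "c = (-1) ^ n * fact n / Gamma (a + b + 2 * real n + 2)"
  define T where "T p = jacobi_integral a b (jacobi_bernstein a b n * p) - coeff p n * c" for p
  have "T p = 0"
  proof (rule linear_functional_poly_eq_0[where n = n and T = T])
    show "T (p + q) = T p + T q" for p q
      using assms by (simp add: T_def distrib_left distrib_right jacobi_integral_add)
    show "T (smult c p) = c * T p" for c p
      by (simp add: T_def jacobi_integral_smult right_diff_distrib)
    show "T (monom 1 k) = 0" if "k \<le> n" for k
      using jacobi_bernstein_moment[OF assms(1,2) that] by (simp add: T_def c_def)
  qed fact
  then show ?thesis by (simp add: T_def c_def)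
qed

text \<open>Pairing \<open>p\<close> with the orthogonal polynomial of its own degree gives a
  nonzero multiple of its leading coefficient. This takes the place of positivity of the integral of
  \<open>p^2\<close>.\<close>

lemma jacobi_integral_nondegenerate:
  assumes ab: "a > -1" "b > -1"
    and 0: "\<And>k. k \<le> degree p \<Longrightarrow> jacobi_integral a b (p * monom 1 k) = 0"
  shows "p = 0"
proof -
  have "jacobi_integral a b (p * jacobi_bernstein a b (degree p)) = 0"
    by (rule linear_functional_poly_eq_0[where n = "degree p" and T = "\<lambda>q. jacobi_integral a b (p * q)"])
       (auto simp: distrib_left jacobi_integral_add[OF ab] jacobi_integral_smult 0
          degree_jacobi_bernstein)
  moreover have "Gamma (a + b + 2 * real (degree p) + 2) > 0"
    using ab by (intro Gamma_real_pos) auto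
  ultimately have "lead_coeff p = 0"
    using jacobi_bernstein_pairing[OF ab order_refl, of p] by (simp add: mult.commute)
  then show ?thesis by simp
qed

text \<open>The moment conditions are triangular: adding a multiple of
  \<open>jacobi_bernstein a b n\<close>, whose own moment of order \<open>n\<close> is
  \<open>h\<close>, corrects that moment and leaves the lower ones unchanged.\<close>

lemma ex_poly_prescribed_moments:
  assumes ab: "a > -1" "b > -1"
  shows "\<exists>p. degree p \<le> n - 1 \<and> (\<forall>k<n. jacobi_integral a b (p * monom 1 k) = v k)"
proof (induction n)
  case 0
  show ?case by (rule exI[of _ 0]) simp
next
  case (Suc n)
  then obtain p where p: "degree p \<le> n - 1" "\<And>k. k < n \<Longrightarrow> jacobi_integral a b (p * monom 1 k) = v k"
    by blast
  define h where "h = (-1) ^ n * fact n / Gamma (a + b + 2 * real n + 2)"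
  have "Gamma (a + b + 2 * real n + 2) > 0"
    using ab by (intro Gamma_real_pos) auto
  then have "h \<noteq> 0"
    by (simp add: h_def)
  define q where
    "q = p + smult ((v n - jacobi_integral a b (p * monom 1 n)) / h) (jacobi_bernstein a b n)"
  have "degree q \<le> n"
    unfolding q_def using p(1) degree_jacobi_bernstein[of a b n]
    by (intro degree_add_le order_trans[OF degree_smult_le]) auto
  moreover have "jacobi_integral a b (q * monom 1 k) = v k" if "k < Suc n" for k
  proof -
    have "jacobi_integral a b (q * monom 1 k) = jacobi_integral a b (p * monom 1 k)
        + (v n - jacobi_integral a b (p * monom 1 n)) / h * (if k = n then h else 0)"
      using that by (simp add: q_def h_def distrib_right jacobi_integral_add[OF ab]
          jacobi_integral_smult jacobi_bernstein_moment[OF ab])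
    then show ?thesis
      using p(2)[of k] that \<open>h \<noteq> 0\<close> by (cases "k = n") auto
  qed
  ultimately show ?case by (intro exI[of _ q]) auto
qed

section \<open>Duality: existence, uniqueness and moments of the dual Bernstein polynomials\<close>

lemma jacobi_inner_Bernstein:
  "jacobi_inner a b (Bernstein n j) (poly p)
     = real (n choose j) * jacobi_integral a b (p * (monom 1 j * [:1, -1:] ^ (n - j)))"
proof -
  have "jacobi_inner a b (Bernstein n j) (poly p)
      = jacobi_integral a b (smult (real (n choose j)) (p * (monom 1 j * [:1, -1:] ^ (n - j))))"
    by (simp add: jacobi_inner_def jacobi_integral_def Bernstein_def poly_monom mult_ac)
  then show ?thesis by (simp add: jacobi_integral_smult)
qed

text \<open>Serves in both directions: to build powers of \<open>1 - x\<close> from pure powers of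
  \<open>x\<close>, and to descend from total degree \<open>n\<close> to lower degrees.\<close>

lemma jacobi_integral_bernstein_step:
  assumes "a > -1" "b > -1"
  shows "jacobi_integral a b (p * (monom 1 j * [:1, -1:] ^ Suc l))
       = jacobi_integral a b (p * (monom 1 j * [:1, -1:] ^ l))
       - jacobi_integral a b (p * (monom 1 (Suc j) * [:1, -1:] ^ l))"
proof -
  have "p * (m * Y ^ Suc l) = p * (m * Y ^ l) - p * (X * m * Y ^ l)" if "Y = 1 - X" for X Y m :: "real poly"
    by (simp add: that algebra_simps)
  moreover have "[:1, -1:] = (1 :: real poly) - [:0, 1:]"
    by (simp add: one_pCons)
  ultimately have "p * (monom 1 j * [:1, -1:] ^ Suc l)
      = p * (monom 1 j * [:1, -1:] ^ l) - p * ([:0, 1:] * monom 1 j * [:1, -1:] ^ l)"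
    by blast
  then show ?thesis
    by (simp only: monom_Suc_eq_mult jacobi_integral_diff[OF assms])
qed

text \<open>The pairing of \<open>x\<^sup>j (1 - x)\<^sup>l\<close> with the \<open>i\<close>-th dual Bernstein polynomial: duality gives the
  case \<open>j + l = n\<close>, and \<open>1 = x + (1 - x)\<close> the others through Pascal's rule.\<close>

definition dual_moment :: "nat \<Rightarrow> nat \<Rightarrow> nat \<Rightarrow> nat \<Rightarrow> real" where
  "dual_moment n i j l = (if j \<le> i then real ((n - j - l) choose (i - j)) / real (n choose i) else 0)"

text \<open>Pascal's rule for \<open>j < i\<close>. For \<open>j = i\<close> the last term is 0 and
  the other two agree; for \<open>j > i\<close> everything is 0.\<close>

lemma dual_moment_Suc:
  assumes "i \<le> n" "j + Suc l \<le> n"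
  shows "dual_moment n i j (Suc l) = dual_moment n i j l - dual_moment n i (Suc j) l"
proof -
  obtain m where m: "n = j + Suc l + m"
    using assms(2) nat_le_iff_add by blast
  show ?thesis
  proof (cases "Suc j \<le> i")
    case True
    then obtain r where "i = Suc j + r"
      using nat_le_iff_add by blast
    then show ?thesis
      by (simp add: dual_moment_def m add_divide_distrib)
  qed (auto simp: dual_moment_def m)
qed

text \<open>Both sides obey the same recurrence in \<open>l\<close>, so prescribing the moments of
  the pure powers of \<open>x\<close> suffices.\<close>

lemma jacobi_integral_dual_moment:
  assumes ab: "a > -1" "b > -1" and "i \<le> n"
    and mom: "\<And>k. k \<le> n \<Longrightarrow> jacobi_integral a b (p * monom 1 k) = dual_moment n i k 0"
  shows "j + l \<le> n \<Longrightarrow>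
    jacobi_integral a b (p * (monom 1 j * [:1, -1:] ^ l)) = dual_moment n i j l"
proof (induction l arbitrary: j)
  case 0
  then show ?case using mom[of j] by simp
next
  case (Suc l)
  then show ?case
    using Suc.IH[of j] Suc.IH[of "Suc j"]
    by (simp only: jacobi_integral_bernstein_step[OF ab] dual_moment_Suc[OF \<open>i \<le> n\<close>])
qed

lemma bernstein_orthogonal_imp_0:
  assumes ab: "a > -1" "b > -1" and "degree p \<le> n"
    and orth: "\<And>j. j \<le> n \<Longrightarrow> jacobi_integral a b (p * (monom 1 j * [:1, -1:] ^ (n - j))) = 0"
  shows "p = 0"
proof -
  \<comment> \<open>\<open>m\<close> is the degree missing to \<open>n\<close>; splitting
    \<open>1 = x + (1 - x)\<close> fills it one unit at a time.\<close>
  have *: "jacobi_integral a b (p * (monom 1 j * [:1, -1:] ^ l)) = 0" if "j + l + m = n" for j l m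
    using that
  proof (induction m arbitrary: j l)
    case 0
    then show ?case using orth[of j] by auto
  next
    case (Suc m)
    then show ?case
      using jacobi_integral_bernstein_step[OF ab, of p j l] Suc.IH[of j "Suc l"] Suc.IH[of "Suc j" l]
      by simp
  qed
  show ?thesis
  proof (rule jacobi_integral_nondegenerate[OF ab])
    fix k assume "k \<le> degree p"
    then show "jacobi_integral a b (p * monom 1 k) = 0"
      using *[of k 0 "n - k"] \<open>degree p \<le> n\<close> by simp
  qed
qed

lemma dual_bernstein_props:
  assumes ab: "a > -1" "b > -1" and "i \<le> n"
  shows degree_dual_bernstein: "degree (dual_bernstein a b n (int i)) \<le> n"
    and dual_bernstein_moment: "j + l \<le> n \<Longrightarrow>
      jacobi_integral a b (dual_bernstein a b n (int i) * (monom 1 j * [:1, -1:] ^ l))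
        = dual_moment n i j l"
proof -
  let ?D = "\<lambda>p. degree p \<le> n \<and>
    (\<forall>j\<le>n. jacobi_inner a b (Bernstein n j) (poly p) = (if int j = int i then 1 else 0))"
  obtain p where deg: "degree p \<le> n"
    and mom: "\<And>k. k \<le> n \<Longrightarrow> jacobi_integral a b (p * monom 1 k) = dual_moment n i k 0"
    \<comment> \<open>\<open>Suc n\<close> because there are \<open>n + 1\<close> moments, those of
      orders 0 to \<open>n\<close>; the degree bound \<open>Suc n - 1\<close> is then
      \<open>n\<close>.\<close>
    using ex_poly_prescribed_moments[OF ab, of "Suc n" "\<lambda>k. dual_moment n i k 0"]
    by (auto simp: less_Suc_eq_le)
  have moment: "jacobi_integral a b (p * (monom 1 j * [:1, -1:] ^ l)) = dual_moment n i j l"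
    if "j + l \<le> n" for j l
    by (rule jacobi_integral_dual_moment[OF ab \<open>i \<le> n\<close> _ that]) (rule mom)
  \<comment> \<open>In total degree \<open>n\<close> the moment is \<open>0 choose (i - j)\<close>
    over \<open>n choose i\<close> for \<open>j \<le> i\<close> and 0 otherwise, hence a Kronecker
    delta after multiplication by \<open>n choose j\<close>.\<close>
  have p: "?D p"
    using deg \<open>i \<le> n\<close> by (auto simp: jacobi_inner_Bernstein moment dual_moment_def)
  have "dual_bernstein a b n (int i) = (THE p. ?D p)"
    using \<open>i \<le> n\<close> by (simp add: dual_bernstein_def)
  also have "\<dots> = p"
  proof (rule the_equality[of ?D, OF p])
    fix q assume q: "?D q"
    have "q - p = 0"
    proof (rule bernstein_orthogonal_imp_0[OF ab])
      show "degree (q - p) \<le> n"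
        using p q by (intro degree_diff_le) auto
      fix j assume "j \<le> n"
      have "jacobi_inner a b (Bernstein n j) (poly q) = jacobi_inner a b (Bernstein n j) (poly p)"
        using p q \<open>j \<le> n\<close> by simp
      then show "jacobi_integral a b ((q - p) * (monom 1 j * [:1, -1:] ^ (n - j))) = 0"
        using \<open>j \<le> n\<close> by (simp add: jacobi_inner_Bernstein left_diff_distrib jacobi_integral_diff[OF ab])
    qed
    then show "q = p" by simp
  qed
  finally have eq: "dual_bernstein a b n (int i) = p" .
  show "degree (dual_bernstein a b n (int i)) \<le> n"
    using deg eq by simp
  show "jacobi_integral a b (dual_bernstein a b n (int i) * (monom 1 j * [:1, -1:] ^ l))
      = dual_moment n i j l" if "j + l \<le> n"
    using moment[OF that] eq by simp
qed

text \<open>Evaluates the pairing with \<open>jacobi_bernstein a b n\<close> twice: in its Bernstein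
  expansion duality leaves only the term \<open>j = i\<close>, while
  \<open>jacobi_bernstein_pairing\<close> yields the wanted coefficient.\<close>

lemma coeff_dual_bernstein:
  assumes ab: "a > -1" "b > -1" and "i \<le> n"
  shows "coeff (dual_bernstein a b n (int i)) n
       = (-1) ^ (n - i) * Gamma (a + b + 2 * real n + 2)
         / (fact n * Gamma (b + real i + 1) * Gamma (a + real (n - i) + 1))"
proof -
  let ?D = "dual_bernstein a b n (int i)"
  let ?c = "\<lambda>j. (-1) ^ j * real (n choose j) / (Gamma (b + real j + 1) * Gamma (a + real (n - j) + 1))"
  have pos: "Gamma (a + b + 2 * real n + 2) > 0" "Gamma (b + real i + 1) > 0"
      "Gamma (a + real (n - i) + 1) > 0"
    using ab by (auto intro!: Gamma_real_pos)
  have "jacobi_integral a b (jacobi_bernstein a b n * ?D)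
      = (\<Sum>j\<le>n. ?c j * jacobi_integral a b (?D * (monom 1 j * [:1, -1:] ^ (n - j))))"
    unfolding jacobi_bernstein_def sum_distrib_right jacobi_integral_sum[OF ab]
    by (simp only: mult.commute[of _ ?D] mult_smult_right jacobi_integral_smult)
  also have "\<dots> = (\<Sum>j\<le>n. if j = i then ?c i / real (n choose i) else 0)"
    by (intro sum.cong refl) (auto simp: dual_bernstein_moment[OF assms] dual_moment_def)
  also have "\<dots> = (-1) ^ i / (Gamma (b + real i + 1) * Gamma (a + real (n - i) + 1))"
    using \<open>i \<le> n\<close> by simp
  finally have "coeff ?D n * ((-1) ^ n * fact n / Gamma (a + b + 2 * real n + 2))
      = (-1) ^ i / (Gamma (b + real i + 1) * Gamma (a + real (n - i) + 1))"
    using jacobi_bernstein_pairing[OF ab degree_dual_bernstein[OF assms]] by simp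
  then have "coeff ?D n = (-1) ^ i / (-1) ^ n * Gamma (a + b + 2 * real n + 2)
      / (fact n * (Gamma (b + real i + 1) * Gamma (a + real (n - i) + 1)))"
    using pos by (simp add: field_simps)
  also have "(-1) ^ i / (-1) ^ n = ((-1) ^ (n - i) :: real)"
    using \<open>i \<le> n\<close> by (auto simp: minus_one_power_iff)
  finally show ?thesis by (simp add: mult_ac)
qed

section \<open>Leading coefficient and orthogonality of the shifted Jacobi polynomials\<close>

lemma degree_shifted_jacobi: "degree (shifted_jacobi a b n) \<le> n"
  unfolding shifted_jacobi_def
  by (intro degree_sum_le order_trans[OF degree_smult_le]) (auto simp: degree_power_eq)

text \<open>Only \<open>l = n\<close> contributes, and the sign of
  \<open>pochhammer (- real n) n\<close> cancels that of the leading coefficient of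
  \<open>(1 - x)^n\<close>.\<close>

lemma coeff_shifted_jacobi:
  assumes "a > -1"
  shows "coeff (shifted_jacobi a b n) n = pochhammer (real n + a + b + 1) n / fact n"
proof -
  have pos: "pochhammer (a + 1) n > 0"
    using assms by (intro pochhammer_pos) auto
  have Y: "coeff ([:1, -1:] ^ l) n = (if l = n then (-1) ^ n else 0 :: real)" if "l \<le> n" for l
  proof (cases "l = n")
    case True
    have "lead_coeff ([:1, -1:] ^ n) = (-1 :: real) ^ n"
      by (simp add: lead_coeff_power)
    then show ?thesis using True by (simp add: degree_power_eq)
  next
    case False
    then show ?thesis using that by (auto intro!: coeff_eq_0 simp: degree_power_eq)
  qed
  have "coeff (shifted_jacobi a b n) n = pochhammer (a + 1) n / fact n
      * (\<Sum>l=0..n. if l = n then pochhammer (- real n) n * pochhammer (real n + a + b + 1) n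
          / (pochhammer (a + 1) n * fact n) * (-1) ^ n else 0)"
    unfolding shifted_jacobi_def coeff_smult coeff_sum
    by (intro arg_cong2[of _ _ _ _ "(*)"] sum.cong refl) (auto simp: Y)
  also have "\<dots> = pochhammer (real n + a + b + 1) n / fact n"
    using pos by (simp add: pochhammer_same)
  finally show ?thesis .
qed

lemma shifted_jacobi_orthogonal:
  assumes ab: "a > -1" "b > -1" and "k < n"
  shows "jacobi_integral a b (shifted_jacobi a b n * monom 1 k) = 0"
proof -
  \<comment> \<open>\<open>m < n\<close> is the order of the rising factorial in \<open>l\<close>
    left by the quotient of Gamma values below; the constant \<open>c\<close> collects the factors
    free of \<open>l\<close>.\<close>
  define m where "m = n - 1 - k"
  have m: "n = m + k + 1" using \<open>k < n\<close> by (simp add: m_def)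
  define c where "c = Gamma (b + real k + 1) * Gamma (a + 1) / Gamma (real n + a + b + 1)"
  have "jacobi_integral a b (shifted_jacobi a b n * monom 1 k)
      = pochhammer (a + 1) n / fact n
        * (\<Sum>l\<le>n. pochhammer (- real n) l * pochhammer (real n + a + b + 1) l
          / (pochhammer (a + 1) l * fact l) * Beta (b + real k + 1) (a + real l + 1))"
    unfolding shifted_jacobi_def mult_smult_left sum_distrib_right jacobi_integral_smult jacobi_integral_sum[OF ab]
    by (simp only: atLeast0AtMost mult.commute[of _ "monom 1 k"] jacobi_integral_Beta[OF ab])
  also have "(\<Sum>l\<le>n. pochhammer (- real n) l * pochhammer (real n + a + b + 1) l
          / (pochhammer (a + 1) l * fact l) * Beta (b + real k + 1) (a + real l + 1))
      = (\<Sum>l\<le>n. c * ((-1) ^ l * real (n choose l) * pochhammer (a + b + real k + 2 + real l) m))"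
  proof (rule sum.cong[OF refl], goal_cases)
    case (1 l)
    \<comment> \<open>Since \<open>a + b\<close> is only known to exceed -2, the first bound depends
      on \<open>n \<ge> 1\<close>, which comes from \<open>k < n\<close>.\<close>
    have pos: "Gamma (real n + a + b + 1) > 0" "pochhammer (a + 1) l > 0" "Gamma (a + 1) > 0"
       "Gamma (a + b + real k + 2 + real l) > 0" "Gamma (a + real l + 1) > 0"
      using ab m by (auto intro!: Gamma_real_pos pochhammer_pos)
    have p1: "pochhammer (a + 1) l = Gamma (a + real l + 1) / Gamma (a + 1)"
      using ab by (subst pochhammer_Gamma) (auto simp: add_ac nonpos_Ints_def)
    have p2: "pochhammer (real n + a + b + 1) l = Gamma (real n + a + b + 1 + real l) / Gamma (real n + a + b + 1)"
      using ab m by (subst pochhammer_Gamma) (auto simp: add_ac nonpos_Ints_def)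
    have p3: "pochhammer (a + b + real k + 2 + real l) m
        = Gamma (real n + a + b + 1 + real l) / Gamma (a + b + real k + 2 + real l)"
      using ab m by (subst pochhammer_Gamma) (auto simp: add_ac nonpos_Ints_def)
    have p4: "pochhammer (- real n) l / fact l = (-1) ^ l * real (n choose l)"
      using 1 by (simp add: binomial_gbinomial gbinomial_pochhammer flip: power_mult_distrib)
    have "Beta (b + real k + 1) (a + real l + 1) / pochhammer (a + 1) l
        = Gamma (b + real k + 1) * Gamma (a + 1) / Gamma (a + b + real k + 2 + real l)"
      using pos unfolding Beta_def p1 by (simp add: add_ac)
    then have "Beta (b + real k + 1) (a + real l + 1) / pochhammer (a + 1) l * pochhammer (real n + a + b + 1) l
        = c * pochhammer (a + b + real k + 2 + real l) m"
      unfolding p2 p3 c_def by simp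
    then have "pochhammer (- real n) l / fact l
        * (Beta (b + real k + 1) (a + real l + 1) / pochhammer (a + 1) l
           * pochhammer (real n + a + b + 1) l)
       = (-1) ^ l * real (n choose l) * (c * pochhammer (a + b + real k + 2 + real l) m)"
      by (simp only: p4)
    then show ?case by (simp add: mult_ac)
  qed
  also have "\<dots> = 0"
  proof -
    have "m < n" using m by simp
    then show ?thesis
      using alternating_binomial_sum_pochhammer[of m n "a + b + real k + 2"]
      by (simp flip: sum_distrib_left)
  qed
  finally show ?thesis by simp
qed

section \<open>The differential operator: orthogonality and leading coefficient\<close>

lemma dual_bernstein_operator_orthogonal:
  assumes ab: "a > -1" "b > -1" and "i \<le> n" "k < n"
    and c: "c = real i * (real n - real i + a + 1) / (real n - real i + 1)"
  shows "jacobi_integral (a + 1) b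
    (([:0, 1:] * pderiv (dual_bernstein a b n (int i))
      + smult (real i + b + 1) (dual_bernstein a b n (int i))
      - smult c (dual_bernstein a b n (int i - 1))) * monom 1 k) = 0"
proof -
  define D where "D = dual_bernstein a b n (int i)"
  define E where "E = dual_bernstein a b n (int i - 1)"
  define X :: "real poly" where "X = [:0, 1:]"
  define Y :: "real poly" where "Y = [:1, -1:]"
  define f where "f = D * monom 1 k"
  have D: "jacobi_integral a b (D * (monom 1 j * Y ^ l)) = dual_moment n i j l" if "j + l \<le> n" for j l
    unfolding D_def Y_def using that by (rule dual_bernstein_moment[OF ab \<open>i \<le> n\<close>])
  \<comment> \<open>For \<open>i = 0\<close> the factor \<open>c\<close> is 0. Otherwise absorption
    turns \<open>n choose (i - 1)\<close> into \<open>n choose i\<close>, which cancels the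
    denominator \<open>n - i + 1\<close> of \<open>c\<close>.\<close>
  have E: "c * jacobi_integral a b (E * (monom 1 k * Y ^ 1))
      = (if Suc k \<le> i then (real n - real i + a + 1) / real (n choose i)
          * real ((n - Suc k) choose (i - Suc k)) else 0)"
  proof (cases i)
    case 0
    then show ?thesis by (simp add: c)
  next
    case (Suc r)
    have "Suc r * (n choose Suc r) = (n - r) * (n choose r)"
      by (simp only: binomial_absorption binomial_absorb_comp)
    then have "real (Suc r) * real (n choose Suc r) = real (n - r) * real (n choose r)"
      by (simp only: flip: of_nat_mult)
    then have ch: "real i / real (n choose r) = (real n - real i + 1) / real (n choose i)"
      using \<open>i \<le> n\<close> Suc by (simp add: field_simps of_nat_diff)
    have "E = dual_bernstein a b n (int r)"
      using Suc by (simp add: E_def)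
    then have "jacobi_integral a b (E * (monom 1 k * Y ^ 1)) = dual_moment n r k 1"
      unfolding Y_def using Suc \<open>i \<le> n\<close> \<open>k < n\<close> by (simp only: dual_bernstein_moment[OF ab])
    then have "c * jacobi_integral a b (E * (monom 1 k * Y ^ 1))
       = (real i / real (n choose r)) / (real n - real i + 1) * (real n - real i + a + 1)
         * (if k \<le> r then real ((n - k - 1) choose (r - k)) else 0)"
      by (simp add: dual_moment_def c)
    then show ?thesis
      unfolding ch using Suc \<open>i \<le> n\<close> by auto
  qed
  have "pderiv f = D * pderiv (monom 1 k) + monom 1 k * pderiv D"
    by (simp add: f_def pderiv_mult)
  moreover have "X * (D * pderiv (monom 1 k)) = smult (real k) (D * monom 1 k)"
    using x_pderiv_monom[of k] unfolding X_def
    by (metis mult.left_commute mult_smult_right)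
  ultimately have Xf: "X * pderiv f = smult (real k) (D * monom 1 k) + X * pderiv D * monom 1 k"
    by (simp add: algebra_simps)
  have mon: "monom 1 (Suc k) = X * monom 1 k"
    unfolding X_def by (rule monom_Suc_eq_mult)
  \<comment> \<open>The bracket is the integrand of \<open>jacobi_integral_by_parts\<close> for
    \<open>f\<close>. The other terms are free of derivatives, and \<open>k < n\<close> keeps their
    cofactors of \<open>D\<close> and \<open>E\<close> within degree \<open>n\<close>.\<close>
  have eq: "Y * ((X * pderiv D + smult (real i + b + 1) D - smult c E) * monom 1 k)
      = (X * Y * pderiv f + smult (b + 1) (Y * f) - smult (a + 1) (X * f))
        + smult (real i - real k) (D * (monom 1 k * Y ^ 1))
        + smult (a + 1) (D * (monom 1 (Suc k) * Y ^ 0)) - smult c (E * (monom 1 k * Y ^ 1))"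
  proof -
    have "X * Y * pderiv f = Y * (X * pderiv f)"
      by (simp only: mult_ac)
    then show ?thesis
      unfolding Xf mon by (simp add: f_def smult_add_left smult_diff_left algebra_simps)
  qed
  have "jacobi_integral (a + 1) b ((X * pderiv D + smult (real i + b + 1) D - smult c E) * monom 1 k)
      = (real i - real k) * dual_moment n i k 1 + (a + 1) * dual_moment n i (Suc k) 0
        - c * jacobi_integral a b (E * (monom 1 k * Y ^ 1))"
    using jacobi_integral_by_parts[OF ab, of f] D[of k 1] D[of "Suc k" 0] \<open>k < n\<close>
    unfolding jacobi_integral_shift Y_def[symmetric] eq X_def[symmetric]
    by (simp only: jacobi_integral_add[OF ab] jacobi_integral_diff[OF ab] jacobi_integral_smult)
  also have "\<dots> = 0"
  proof (cases "Suc k \<le> i")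
    case True
    define r where "r = i - Suc k"
    define m where "m = n - Suc k"
    have r: "i = Suc k + r" and m: "n = Suc k + m" "r \<le> m"
      using True \<open>i \<le> n\<close> \<open>k < n\<close> by (simp_all add: r_def m_def)
    \<comment> \<open>Over the common denominator \<open>n choose i\<close>, with
      \<open>n - i = m - r\<close>, the claim is exactly this absorption identity.\<close>
    have "Suc r * (m choose Suc r) = (m - r) * (m choose r)"
      by (simp only: binomial_absorption binomial_absorb_comp)
    then have "real (Suc r) * real (m choose Suc r) = real (m - r) * real (m choose r)"
      by (simp only: flip: of_nat_mult)
    then have "(1 + real r) * real (m choose Suc r) = (real m - real r) * real (m choose r)"
      using \<open>r \<le> m\<close> by (simp add: of_nat_diff)
    moreover have "i - k = Suc r" "n - k - 1 = m" "real i - real k = 1 + real r" "real n - real i = real m - real r"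
      using r m by simp_all
    moreover have "real (n choose i) > 0"
      using \<open>i \<le> n\<close> by simp
    ultimately show ?thesis
      unfolding E using True by (simp add: dual_moment_def flip: r_def m_def) (simp add: field_simps)
  next
    \<comment> \<open>For \<open>k = i\<close> the factor \<open>i - k\<close> removes the first
      term; for \<open>k > i\<close> its moment is already 0.\<close>
    case False
    then show ?thesis
      unfolding E by (auto simp: dual_moment_def)
  qed
  finally show ?thesis
    unfolding D_def E_def X_def .
qed

lemma coeff_dual_bernstein_operator:
  assumes ab: "a > -1" "b > -1" and "i \<le> n"
    and c: "c = real i * (real n - real i + a + 1) / (real n - real i + 1)"
  shows "coeff ([:0, 1:] * pderiv (dual_bernstein a b n (int i))
      + smult (real i + b + 1) (dual_bernstein a b n (int i))
      - smult c (dual_bernstein a b n (int i - 1))) n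
    = dual_A a b n i * ((real n + b + 1) / (real n - real i + 1))
      * (pochhammer (real n + a + b + 2) n / fact n)"
proof -
  define d where "d = coeff (dual_bernstein a b n (int i)) n"
  have Gpos: "Gamma (a + 1) > 0" "Gamma (b + 1) > 0" "Gamma (real n + a + b + 2) > 0"
      "Gamma (a + b + 2) > 0"
    using ab by (auto intro!: Gamma_real_pos)
  define w where "w = real i * (b + real i) / (real n - real i + 1)"
  \<comment> \<open>Lowering \<open>i\<close> by one flips the sign and shifts two Gamma arguments,
    giving the ratio \<open>-(b + i) / (a + n - i + 1)\<close>; the denominator cancels against
    \<open>c\<close>.\<close>
  have "c * coeff (dual_bernstein a b n (int i - 1)) n = - d * w"
  proof (cases i)
    case 0
    then show ?thesis by (simp add: c w_def)
  next
    case (Suc r)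
    define G where "G = (-1) ^ (n - i) * Gamma (a + b + 2 * real n + 2) / fact n"
    have pos: "b + real i > 0" "a + real (n - i) + 1 > 0" "Gamma (b + real i) > 0"
      using ab Suc by (auto intro!: Gamma_real_pos)
    have shift: "b + real r + 1 = b + real i" "a + real (n - r) + 1 = a + real (n - i) + 1 + 1" "n - r = Suc (n - i)"
      "int i - 1 = int r"
      using Suc \<open>i \<le> n\<close> by simp_all
    have "r \<le> n" using Suc \<open>i \<le> n\<close> by simp
    then have E: "coeff (dual_bernstein a b n (int i - 1)) n
        = - G / (Gamma (b + real i) * Gamma (a + real (n - i) + 1 + 1))"
      unfolding shift(4) coeff_dual_bernstein[OF ab \<open>r \<le> n\<close>] shift(1,2) unfolding shift(3)
      by (simp add: G_def)
    have d: "d = G / (Gamma (b + real i + 1) * Gamma (a + real (n - i) + 1))"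
      unfolding d_def coeff_dual_bernstein[OF ab \<open>i \<le> n\<close>] by (simp add: G_def)
    have G1: "Gamma (b + real i + 1) = (b + real i) * Gamma (b + real i)"
      using pos by (intro Gamma_plus1) (auto simp: nonpos_Ints_def)
    have G2: "Gamma (a + real (n - i) + 1 + 1) = (a + real (n - i) + 1) * Gamma (a + real (n - i) + 1)"
      using pos by (intro Gamma_plus1) (auto simp: nonpos_Ints_def)
    have "(a + real (n - i) + 1) * coeff (dual_bernstein a b n (int i - 1)) n = - d * (b + real i)"
    proof -
      have "u * (- G / (x * (u * y))) = - (G / (v * x * y)) * v" if "u > 0" "v > 0" for u v x y
        using that by simp
      from this[OF pos(2,1)] show ?thesis
        unfolding E d G1 G2 .
    qed
    moreover have "c = real i / (real n - real i + 1) * (a + real (n - i) + 1)"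
      using \<open>i \<le> n\<close> by (simp add: c of_nat_diff algebra_simps)
    ultimately have "c * coeff (dual_bernstein a b n (int i - 1)) n
        = real i / (real n - real i + 1) * (- d * (b + real i))"
      by (simp only: mult.assoc)
    then show ?thesis
      by (simp add: w_def)
  qed
  moreover have "coeff ([:0, 1:] * pderiv (dual_bernstein a b n (int i))) n = real n * d"
    unfolding d_def by (cases n) (simp_all add: coeff_pderiv)
  ultimately have "coeff ([:0, 1:] * pderiv (dual_bernstein a b n (int i))
      + smult (real i + b + 1) (dual_bernstein a b n (int i))
      - smult c (dual_bernstein a b n (int i - 1))) n
    = d * (real n + real i + b + 1 + w)"
    by (simp add: d_def algebra_simps del: mult_pCons_left)
  \<comment> \<open>Clearing the denominator: \<open>(n + i + b + 1) * (n - i + 1) + i * (b + i) =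
    (n + 1) * (n + b + 1)\<close>.\<close>
  also have "\<dots> = d * ((real n + 1) * ((real n + b + 1) / (real n - real i + 1)))"
    using \<open>i \<le> n\<close> by (simp add: w_def field_simps)
  also have "\<dots> = dual_A a b n i * ((real n + b + 1) / (real n - real i + 1))
      * (pochhammer (real n + a + b + 2) n / fact n)"
  proof -
    have p1: "pochhammer (a + 1) (n - i) = Gamma (a + real (n - i) + 1) / Gamma (a + 1)"
      using ab by (subst pochhammer_Gamma) (auto simp: add_ac nonpos_Ints_def)
    have p2: "pochhammer (b + 1) i = Gamma (b + real i + 1) / Gamma (b + 1)"
      using ab by (subst pochhammer_Gamma) (auto simp: add_ac nonpos_Ints_def)
    have nonpos: "a + b + 2 \<notin> \<int>\<^sub>\<le>\<^sub>0" "real n + a + b + 2 \<notin> \<int>\<^sub>\<le>\<^sub>0"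
      using ab by (auto simp: nonpos_Ints_def)
    have sums: "a + b + 1 + 1 = a + b + 2" "a + b + 2 + real n = real n + a + b + 2"
        "real n + a + b + 2 + real n = a + b + 2 * real n + 2"
      by simp_all
    have p3: "pochhammer (a + b + 2) n = Gamma (real n + a + b + 2) / Gamma (a + b + 2)"
      using pochhammer_Gamma[OF nonpos(1), of n] unfolding sums(2) .
    have p4: "pochhammer (real n + a + b + 2) n
        = Gamma (a + b + 2 * real n + 2) / Gamma (real n + a + b + 2)"
      using pochhammer_Gamma[OF nonpos(2), of n] unfolding sums(3) .
    \<comment> \<open>The \<open>g\<close>s stand for the four Gamma values in \<open>Gpos\<close>,
      all of which cancel.\<close>
    have "s * (real n + 1) * (g4 / g5) / (g1 * g2 / g5 * (x / g1) * (y / g2)) * (h / g4 / F)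
        = s * h / (F * y * x) * (real n + 1)"
      if "g1 > 0" "g2 > 0" "g4 > 0" "g5 > 0" for s g1 g2 g4 g5 x y h F :: real
      using that by (simp add: mult_ac)
    from this[OF Gpos]
    have "dual_A a b n i * (pochhammer (real n + a + b + 2) n / fact n) = d * (real n + 1)"
      unfolding d_def coeff_dual_bernstein[OF ab \<open>i \<le> n\<close>] dual_A_def dual_K_def dual_sigma_def
        sums(1) p1 p2 p3 p4 .
    moreover have "x * (y * v) = A * v * p" if "A * p = x * y" for A p x y v :: real
      using that by algebra
    ultimately show ?thesis by blast
  qed
  finally show ?thesis .
qed

section \<open>Identification of both sides by degree and orthogonality\<close>

theorem theorem3p3:
  fixes \<alpha> \<beta> :: real and n i :: nat
  assumes "\<alpha> > -1" and "\<beta> > -1" and "i \<le> n"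
  shows "[:0, 1:] * pderiv (dual_bernstein \<alpha> \<beta> n (int i))
           + smult (real i + \<beta> + 1) (dual_bernstein \<alpha> \<beta> n (int i))
         = smult (real i * (real n - real i + \<alpha> + 1) / (real n - real i + 1))
             (dual_bernstein \<alpha> \<beta> n (int i - 1))
           + smult (dual_A \<alpha> \<beta> n i * ((real n + \<beta> + 1) / (real n - real i + 1)))
               (shifted_jacobi (\<alpha> + 1) \<beta> n)"
proof -
  let ?D = "dual_bernstein \<alpha> \<beta> n (int i)" and ?E = "dual_bernstein \<alpha> \<beta> n (int i - 1)"
  let ?R = "shifted_jacobi (\<alpha> + 1) \<beta> n"
  define c where "c = real i * (real n - real i + \<alpha> + 1) / (real n - real i + 1)"
  define \<gamma> where "\<gamma> = dual_A \<alpha> \<beta> n i * ((real n + \<beta> + 1) / (real n - real i + 1))"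
  define q where "q = [:0, 1:] * pderiv ?D + smult (real i + \<beta> + 1) ?D - smult c ?E"
  have ab: "\<alpha> + 1 > -1" "\<beta> > -1" using assms by auto
  have "coeff q n = \<gamma> * coeff ?R n"
    using coeff_dual_bernstein_operator[OF assms c_def] ab
    by (simp add: q_def \<gamma>_def coeff_shifted_jacobi add_ac)
  then have coeff: "coeff (q - smult \<gamma> ?R) n = 0" by simp
  have "degree ?E \<le> n"
  proof (cases i)
    case 0
    then show ?thesis by (simp add: dual_bernstein_def)
  next
    case (Suc r)
    then show ?thesis using degree_dual_bernstein[of \<alpha> \<beta> r n] assms by simp
  qed
  moreover have D: "degree ?D \<le> n"
    using assms by (rule degree_dual_bernstein)
  moreover have "degree ([:0, 1:] * pderiv ?D) \<le> n"
  proof (rule degree_le, intro allI impI)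
    fix m assume "n < m"
    then show "coeff ([:0, 1:] * pderiv ?D) m = 0"
      using D by (cases m) (auto simp: coeff_pderiv coeff_eq_0)
  qed
  ultimately have "degree (q - smult \<gamma> ?R) \<le> n"
    unfolding q_def
    by (intro degree_diff_le degree_add_le order_trans[OF degree_smult_le] degree_shifted_jacobi)
  have "q - smult \<gamma> ?R = 0"
  proof (rule ccontr)
    \<comment> \<open>Being nonzero turns the vanishing coefficient at \<open>n\<close> into a
      degree below \<open>n\<close>; for \<open>n = 0\<close> the zero polynomial would violate that
      strict bound. Orthogonality to all \<open>x^k\<close> with \<open>k < n\<close> then covers
      every power up to the degree.\<close>
    assume nz: "q - smult \<gamma> ?R \<noteq> 0"
    have "degree (q - smult \<gamma> ?R) \<noteq> n"
      using coeff nz by (metis leading_coeff_0_iff)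
    then have "degree (q - smult \<gamma> ?R) < n"
      using \<open>degree (q - smult \<gamma> ?R) \<le> n\<close> by simp
    moreover
    have "jacobi_integral (\<alpha> + 1) \<beta> (q * monom 1 k) = 0" if "k < n" for k
      unfolding q_def by (rule dual_bernstein_operator_orthogonal[OF assms that c_def])
    then have "jacobi_integral (\<alpha> + 1) \<beta> ((q - smult \<gamma> ?R) * monom 1 k) = 0" if "k < n" for k
      using shifted_jacobi_orthogonal[OF ab that] that
      by (simp add: left_diff_distrib jacobi_integral_diff[OF ab] jacobi_integral_smult)
    ultimately have "q - smult \<gamma> ?R = 0"
      by (intro jacobi_integral_nondegenerate[OF ab]) simp
    then show False using nz by contradiction
  qed
  then show ?thesis
    unfolding q_def c_def \<gamma>_def by (simp only: diff_eq_eq eq_diff_eq add_0 add_ac)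
qed

end
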